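(* Suppose that the trust-region subproblem $\min_{\|x\|\le\Delta}\{\frac12 x^TAx+x^Tg\}$ is in easy case, and that $\|x_*\|=\Delta$ and $\lambda_*=0$. Then: (i) $\lambda_*(\varepsilon)$ and $x_*(\varepsilon)$ are continuous at $\varepsilon=0$, with $\lim_{\varepsilon\to0}\lambda_*(\varepsilon)=\lambda_*$ and $\lim_{\varepsilon\to0}x_*(\varepsilon)=x_*$; (ii) if $x_*^TA^{-1}(e+Ex_* )\ne0$, then both $\lambda_*(\varepsilon)$ and $x_*(\varepsilon)$ are non-differentiable at $\varepsilon=0$; (iii) if $x_*^TA^{-1}(e+Ex_* )=0$, then both $\lambda_*(\varepsilon)$ and $x_*(\varepsilon)$ are differentiable at $\varepsilon=0$; moreover, $\lambda_*'(0)=0$ and $x_*'(0)=-A^{-1}(Ex_*+e)$.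
   Context: $\|\cdot\|$ is the Euclidean norm. $A\in\mathbb R^{n\times n}$ is symmetric, $0\ne g\in\mathbb R^n$, $\Delta>0$; $E\in\mathbb R^{n\times n}$ is symmetric, $e\in\mathbb R^n$, $\varepsilon\in\mathbb R$; $A(\varepsilon)=A+\varepsilon E$, $g(\varepsilon)=g+\varepsilon e$. Trust-region subproblem (TRS): for symmetric $B\in\mathbb R^{n\times n}$ and $b\in\mathbb R^n$, consider $\min_{\|x\|\le\Delta}\{\frac12x^TBx+x^Tb\}$. A vector $x_*$ with $\|x_*\|\le\Delta$ is a global minimizer iff there is a Lagrange multiplier $\lambda_*\ge0$ with $(B+\lambda_*I)x_*=-b$, $\lambda_*(\Delta-\|x_*\|)=0$ and $B+\lambda_*I$ positive semidefinite. The TRS is in easy case if $B+\lambda_*I$ is positive definite (equivalently $\lambda_*$ exceeds minus the smallest eigenvalue of $B$); then the minimizer is unique. $(\lambda_*,x_* )$ denotes the multiplier and solution for $(B,b)=(A,g)$, and $(\lambda_*(\varepsilon),x_*(\varepsilon))$ those for $(B,b)=(A(\varepsilon),g(\varepsilon))$ (the perturbed TRS), so $\lambda_*(0)=\lambda_*$, $x_*(0)=x_*$. Standing assumption: the $\varepsilon$ considered (close to $0$) are such that the perturbed TRS is also in easy case. *)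

theory Defs
  imports "HOL-Analysis.Analysis"
begin

text \<open>Positive (semi)definiteness is only applied to symmetric matrices below.\<close>

definition pos_semidef :: "real ^ 'n ^ 'n \<Rightarrow> bool" where
  "pos_semidef M \<longleftrightarrow> (\<forall>x. x \<bullet> (M *v x) \<ge> 0)"

definition pos_def :: "real ^ 'n ^ 'n \<Rightarrow> bool" where
  "pos_def M \<longleftrightarrow> (\<forall>x. x \<noteq> 0 \<longrightarrow> x \<bullet> (M *v x) > 0)"

definition trs_objective :: "real ^ 'n ^ 'n \<Rightarrow> real ^ 'n \<Rightarrow> real ^ 'n \<Rightarrow> real" where
  "trs_objective B b x = 1 / 2 * (x \<bullet> (B *v x)) + x \<bullet> b"

definition trs_minimizer :: "real ^ 'n ^ 'n \<Rightarrow> real ^ 'n \<Rightarrow> real \<Rightarrow> real ^ 'n \<Rightarrow> bool" where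
  "trs_minimizer B b \<Delta> x \<longleftrightarrow>
     norm x \<le> \<Delta> \<and> (\<forall>y. norm y \<le> \<Delta> \<longrightarrow> trs_objective B b x \<le> trs_objective B b y)"

definition trs_multiplier ::
    "real ^ 'n ^ 'n \<Rightarrow> real ^ 'n \<Rightarrow> real \<Rightarrow> real ^ 'n \<Rightarrow> real \<Rightarrow> bool" where
  "trs_multiplier B b \<Delta> x \<mu> \<longleftrightarrow>
     \<mu> \<ge> 0 \<and> (B + \<mu> *\<^sub>R mat 1) *v x = - b \<and> \<mu> * (\<Delta> - norm x) = 0 \<and>
     pos_semidef (B + \<mu> *\<^sub>R mat 1)"

definition trs_solution ::
    "real ^ 'n ^ 'n \<Rightarrow> real ^ 'n \<Rightarrow> real \<Rightarrow> real \<Rightarrow> real ^ 'n \<Rightarrow> bool" where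
  "trs_solution B b \<Delta> \<mu> x \<longleftrightarrow> trs_minimizer B b \<Delta> x \<and> trs_multiplier B b \<Delta> x \<mu>"

text \<open>The multiplier is uniquely determined by the subproblem (for symmetric B and positive
  radius), so the existential quantifier refers to the Lagrange multiplier.\<close>

definition trs_easy_case :: "real ^ 'n ^ 'n \<Rightarrow> real ^ 'n \<Rightarrow> real \<Rightarrow> bool" where
  "trs_easy_case B b \<Delta> \<longleftrightarrow>
     (\<exists>\<mu> x. trs_solution B b \<Delta> \<mu> x \<and> pos_def (B + \<mu> *\<^sub>R mat 1))"

end

theory Submission imports Defs begin

text \<open>
  Write \<open>y\<close>, \<open>\<mu>\<close> for the perturbed solution and multiplier. Subtracting the two stationarity
  equations gives \<open>A (y - x) = - \<epsilon> (e + E y) - \<mu> y\<close>. As \<open>\<mu> (y - x) \<bullet> y \<ge> 0\<close> by complementarity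
  and \<open>A\<close> is positive definite, \<open>y - x\<close> and hence \<open>\<mu>\<close> are \<open>O(\<epsilon>)\<close>. With \<open>p = A\<^sup>-\<^sup>1 (e + E x)\<close> and
  \<open>z = A\<^sup>-\<^sup>1 x\<close> one gets \<open>y - x = - \<epsilon> p - \<mu> z + O(\<epsilon>\<^sup>2)\<close>, and taking the inner product with \<open>x\<close>
  shows \<open>\<mu> (x \<bullet> z) = max 0 (- \<epsilon> (x \<bullet> p)) + O(\<epsilon>\<^sup>2)\<close>. So both functions have a kink at \<open>0\<close>
  exactly when \<open>x \<bullet> p \<noteq> 0\<close>.
\<close>

section \<open>Positive definite matrices and operator bounds\<close>

lemma pos_def_coercive:
  fixes A :: "real ^ 'n ^ 'n"
  assumes "pos_def A"
  obtains c where "c > 0" "\<And>v. c * (norm v)\<^sup>2 \<le> v \<bullet> (A *v v)"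
proof -
  let ?f = "\<lambda>v. v \<bullet> (A *v v)"
  \<comment> \<open>Compactness of the unit sphere yields a minimizer \<open>u\<close>. The value of
    the form at \<open>u\<close> serves as \<open>c\<close>, since the form is homogeneous of degree
    two.\<close>
  have "continuous_on (sphere 0 1) ?f"
    by (intro continuous_intros linear_continuous_on matrix_vector_mul_bounded_linear)
  moreover have "sphere (0 :: real ^ 'n) 1 \<noteq> {}"
    by simp
  ultimately obtain u where u: "u \<in> sphere 0 1" "\<And>v. v \<in> sphere 0 1 \<Longrightarrow> ?f u \<le> ?f v"
    using continuous_attains_inf[of "sphere (0 :: real ^ 'n) 1" ?f] compact_sphere by blast
  show thesis
  proof
    show "?f u > 0"
      using u(1) assms unfolding pos_def_def by (metis mem_sphere_0 norm_zero zero_neq_one)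
    show "?f u * (norm v)\<^sup>2 \<le> ?f v" for v
    proof (cases "v = 0")
      case False
      have "?f u \<le> ?f (v /\<^sub>R norm v)"
        using False by (intro u(2)) simp
      also have "\<dots> = ?f v / (norm v)\<^sup>2"
        by (simp add: matrix_vector_mult_scaleR power2_eq_square divide_simps)
      finally show ?thesis
        using False by (simp add: field_simps)
    qed simp
  qed
qed

lemma pos_def_invertible:
  fixes A :: "real ^ 'n ^ 'n"
  assumes "pos_def A"
  shows "invertible A"
  using assms inner_zero_right less_irrefl
  unfolding pos_def_def invertible_left_inverse matrix_left_invertible_ker by metis

lemma invertible_matrix_inv_vec:
  fixes A :: "real ^ 'n ^ 'n"
  assumes "invertible A"
  shows "A *v (matrix_inv A *v v) = v" "matrix_inv A *v (A *v v) = v"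
  \<comment> \<open>\<open>matrix_inv\<close> is a Hilbert choice, so invertibility is what supplies
    its two defining identities.\<close>
  using someI_ex[OF assms[unfolded invertible_def]]
  by (simp_all add: matrix_vector_mul_assoc matrix_inv_def)

lemma matrix_vector_bound:
  fixes M :: "real ^ 'n ^ 'm"
  obtains B where "B > 0" "\<And>v. norm (M *v v) \<le> B * norm v"
  using linear_bounded_pos[OF matrix_vector_mul_linear[of M]] by metis

section \<open>Consequences of the optimality conditions\<close>

lemma shifted_matrix_vector:
  fixes B :: "real ^ 'n ^ 'n"
  shows "(B + \<mu> *\<^sub>R mat 1) *v v = B *v v + \<mu> *\<^sub>R v"
  by (simp add: matrix_vector_mult_add_rdistrib flip: scaleR_matrix_vector_assoc)

text \<open>By complementarity \<open>\<mu> y\<close> is an outer normal of the ball at \<open>y\<close>.\<close>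

lemma trs_multiplier_normal:
  assumes "trs_multiplier B b \<Delta> y \<mu>" "norm y \<le> \<Delta>" "norm x \<le> \<Delta>"
  shows "0 \<le> \<mu> * ((y - x) \<bullet> y)"
proof (cases "\<mu> = 0")
  case False
  then have y: "norm y = \<Delta>" and \<mu>: "\<mu> \<ge> 0"
    using assms(1) by (auto simp: trs_multiplier_def)
  have "x \<bullet> y \<le> norm x * norm y"
    by (rule norm_cauchy_schwarz)
  also have "\<dots> \<le> norm y * norm y"
    using assms(3) y by (intro mult_right_mono) auto
  finally show ?thesis
    using \<mu> by (simp add: inner_diff_left power2_norm_eq_inner flip: power2_eq_square)
qed simp

text \<open>The easy case only provides some pair \<open>\<mu>\<close>, \<open>y\<close> with a
  positive definite shift, so \<open>\<mu> = 0\<close> must be shown. If \<open>\<mu> > 0\<close>,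
  semidefiniteness of \<open>A\<close> and the normal inequality have opposite signs and force
  \<open>(y - x) \<bullet> y = 0\<close>. As both points lie on the sphere, \<open>y = x\<close>,
  whence \<open>\<mu> *\<^sub>R x = 0\<close>, which is impossible.\<close>

lemma trs_easy_case_pos_def:
  assumes "trs_easy_case A g \<Delta>" "trs_solution A g \<Delta> 0 x" "norm x = \<Delta>" "\<Delta> > 0"
  shows "pos_def A"
proof -
  obtain \<mu> y where sol: "trs_solution A g \<Delta> \<mu> y" and pd: "pos_def (A + \<mu> *\<^sub>R mat 1)"
    using assms(1) by (auto simp: trs_easy_case_def)
  have y: "norm y \<le> \<Delta>" "\<mu> \<ge> 0" "\<mu> * (\<Delta> - norm y) = 0" "A *v y + \<mu> *\<^sub>R y = - g"
    using sol by (auto simp: trs_solution_def trs_minimizer_def trs_multiplier_def shifted_matrix_vector)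
  have x: "A *v x = - g" "pos_semidef A"
    using assms(2) by (auto simp: trs_solution_def trs_multiplier_def)
  have "\<mu> = 0"
  proof (rule ccontr)
    assume "\<mu> \<noteq> 0"
    have Ad: "A *v (y - x) = - \<mu> *\<^sub>R y"
      unfolding matrix_vector_mult_diff_distrib x(1) y(4)[symmetric] by simp
    have "0 \<le> (y - x) \<bullet> (A *v (y - x))"
      using x(2) by (auto simp: pos_semidef_def)
    moreover have "0 \<le> \<mu> * ((y - x) \<bullet> y)"
      using sol y(1) assms(3) by (intro trs_multiplier_normal[of A g \<Delta>]) (auto simp: trs_solution_def)
    ultimately have "(y - x) \<bullet> y = 0"
      using \<open>\<mu> \<noteq> 0\<close> by (simp add: Ad)
    moreover have "norm y = norm x"
      using \<open>\<mu> \<noteq> 0\<close> y(3) assms(3) by simp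
    then have "y \<bullet> y = x \<bullet> x"
      by (simp add: norm_eq)
    ultimately have "(y - x) \<bullet> (y - x) = 0"
      by (simp add: inner_diff_left inner_diff_right inner_commute)
    then have "\<mu> *\<^sub>R x = 0"
      using Ad by simp
    then show False
      using \<open>\<mu> \<noteq> 0\<close> assms(3,4) by auto
  qed
  with pd show ?thesis by simp
qed

text \<open>Pairing the identity for \<open>A *v (y - x)\<close> with \<open>y - x\<close> lets the
  multiplier term be discarded by its sign; Cauchy-Schwarz and cancelling one factor
  \<open>norm (y - x)\<close> finish. The bound on \<open>\<mu>\<close> solves the same identity for
  \<open>\<mu> *\<^sub>R y\<close>. Leaving \<open>y\<close> on the right is harmless, since
  \<open>norm y \<le> \<Delta>\<close>.\<close>

lemma trs_perturbation_bounds: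
  fixes A E :: "real ^ 'n ^ 'n"
  assumes c: "\<And>v. c * (norm v)\<^sup>2 \<le> v \<bullet> (A *v v)"
    and x: "A *v x = - g" "norm x = \<Delta>"
    and sol: "trs_solution (A + \<epsilon> *\<^sub>R E) (g + \<epsilon> *\<^sub>R e) \<Delta> \<mu> y"
  shows "A *v (y - x) = - \<epsilon> *\<^sub>R (e + E *v y) - \<mu> *\<^sub>R y"
    and "c * norm (y - x) \<le> \<bar>\<epsilon>\<bar> * norm (e + E *v y)"
    and "\<mu> * \<Delta> \<le> \<bar>\<epsilon>\<bar> * norm (e + E *v y) + norm (A *v (y - x))"
proof -
  let ?w = "e + E *v y"
  have y: "norm y \<le> \<Delta>" "\<mu> \<ge> 0" "\<mu> * (\<Delta> - norm y) = 0"
    and m: "trs_multiplier (A + \<epsilon> *\<^sub>R E) (g + \<epsilon> *\<^sub>R e) \<Delta> y \<mu>"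
    using sol by (auto simp: trs_solution_def trs_minimizer_def trs_multiplier_def)
  have "A *v y + \<epsilon> *\<^sub>R (E *v y) + \<mu> *\<^sub>R y = - g - \<epsilon> *\<^sub>R e"
    using m by (simp add: trs_multiplier_def shifted_matrix_vector matrix_vector_mult_add_rdistrib
        flip: scaleR_matrix_vector_assoc)
  then have g: "- g = A *v y + \<epsilon> *\<^sub>R (E *v y) + \<mu> *\<^sub>R y + \<epsilon> *\<^sub>R e"
    by (simp add: eq_diff_eq)
  show Ad: "A *v (y - x) = - \<epsilon> *\<^sub>R ?w - \<mu> *\<^sub>R y"
    unfolding matrix_vector_mult_diff_distrib x(1) g by (simp add: scaleR_add_right)
  have "c * (norm (y - x))\<^sup>2 \<le> (y - x) \<bullet> (A *v (y - x))"
    by (rule c)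
  also have "\<dots> = - \<epsilon> * ((y - x) \<bullet> ?w) - \<mu> * ((y - x) \<bullet> y)"
    unfolding Ad by (simp only: inner_diff_right inner_scaleR_right)
  also have "\<dots> \<le> \<bar>\<epsilon>\<bar> * \<bar>(y - x) \<bullet> ?w\<bar>"
    using trs_multiplier_normal[OF m y(1)] x(2) abs_ge_minus_self[of "\<epsilon> * ((y - x) \<bullet> ?w)"]
    by (fastforce simp: abs_mult)
  also have "\<dots> \<le> \<bar>\<epsilon>\<bar> * (norm (y - x) * norm ?w)"
    by (intro mult_left_mono Cauchy_Schwarz_ineq2) auto
  finally show "c * norm (y - x) \<le> \<bar>\<epsilon>\<bar> * norm ?w"
    by (cases "y = x") (auto simp: power2_eq_square algebra_simps)
  \<comment> \<open>Complementarity allows \<open>\<Delta>\<close> to be replaced by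
    \<open>norm y\<close>, even when \<open>y\<close> is interior, because then
    \<open>\<mu> = 0\<close>.\<close>
  have "\<mu> * \<Delta> = norm (\<mu> *\<^sub>R y)"
    using y by (simp add: algebra_simps)
  also have "\<mu> *\<^sub>R y = - \<epsilon> *\<^sub>R ?w - A *v (y - x)"
    by (simp add: Ad)
  also have "norm \<dots> \<le> \<bar>\<epsilon>\<bar> * norm ?w + norm (A *v (y - x))"
    by (rule order_trans[OF norm_triangle_ineq4]) simp
  finally show "\<mu> * \<Delta> \<le> \<bar>\<epsilon>\<bar> * norm ?w + norm (A *v (y - x))" .
qed

section \<open>Derivatives from quadratic remainders, and kinks\<close>

lemma has_vector_derivative_of_quadratic_bound:
  fixes f :: "real \<Rightarrow> 'a :: real_normed_vector"
  assumes "\<forall>\<^sub>F \<epsilon> in nhds 0. norm (f \<epsilon> - l - \<epsilon> *\<^sub>R v) \<le> C * \<epsilon>\<^sup>2"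
  shows "(f has_vector_derivative v) (at 0)"
proof -
  \<comment> \<open>The filter \<open>nhds 0\<close> includes the point 0 itself, where the bound
    vanishes.\<close>
  have "f 0 = l"
    using eventually_nhds_x_imp_x[OF assms] by simp
  have "((\<lambda>\<epsilon>. C * \<bar>\<epsilon>\<bar>) \<longlongrightarrow> 0) (at (0::real))"
    by (auto intro!: tendsto_eq_intros)
  moreover have "\<forall>\<^sub>F \<epsilon> in at 0. norm ((f \<epsilon> - f 0 - \<epsilon> *\<^sub>R v) /\<^sub>R \<bar>\<epsilon>\<bar>) \<le> C * \<bar>\<epsilon>\<bar>"
    using eventually_nhds_conv_at[THEN iffD1, OF assms, THEN conjunct1] eventually_neq_at_within[of 0]
  proof eventually_elim
    case (elim \<epsilon>)
    have "norm ((f \<epsilon> - f 0 - \<epsilon> *\<^sub>R v) /\<^sub>R \<bar>\<epsilon>\<bar>) \<le> C * \<bar>\<epsilon>\<bar>\<^sup>2 / \<bar>\<epsilon>\<bar>"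
      using divide_right_mono[OF elim(1) abs_ge_zero[of \<epsilon>]] \<open>f 0 = l\<close>
      by (simp add: divide_inverse mult.commute)
    also have "\<dots> = C * \<bar>\<epsilon>\<bar>"
      using elim(2) by (simp add: power2_eq_square del: power2_abs abs_mult_self_eq)
    finally show ?case .
  qed
  ultimately have "((\<lambda>\<epsilon>. (f \<epsilon> - f 0 - \<epsilon> *\<^sub>R v) /\<^sub>R \<bar>\<epsilon>\<bar>) \<longlongrightarrow> 0) (at 0)"
    by (rule Lim_null_comparison[rotated])
  then show ?thesis
    by (simp add: has_vector_derivative_def has_derivative_at2 bounded_linear_scaleR_left
        diff_diff_eq inverse_eq_divide)
qed

lemma abs_not_differentiable_at_0: "\<not> (abs :: real \<Rightarrow> real) differentiable (at 0)"
proof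
  assume "(abs :: real \<Rightarrow> real) differentiable (at 0)"
  then obtain D where "((\<lambda>t. \<bar>t\<bar> / t) \<longlongrightarrow> D) (at (0::real))"
    by (auto simp: real_differentiable_def DERIV_def)
  then have lim: "((\<lambda>t. \<bar>t\<bar> / t) \<longlongrightarrow> D) (at_left 0)" "((\<lambda>t. \<bar>t\<bar> / t) \<longlongrightarrow> D) (at_right 0)"
    by (auto simp: filterlim_at_split)
  have "((\<lambda>t. - 1) \<longlongrightarrow> D) (at_left (0::real))"
    by (rule Lim_transform_eventually[OF lim(1)]) (auto simp: eventually_at_left_field intro!: exI[of _ "- 1"])
  moreover have "((\<lambda>t. 1) \<longlongrightarrow> D) (at_right (0::real))"
    by (rule Lim_transform_eventually[OF lim(2)]) (auto simp: eventually_at_right_field intro!: exI[of _ 1])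
  ultimately show False
    by (auto dest!: tendsto_unique[OF _ _ tendsto_const, rotated])
qed

text \<open>Up to \<open>O(\<epsilon>\<^sup>2)\<close>, \<open>2 (h \<epsilon> - l) + \<epsilon> s = \<bar>s\<bar> \<bar>\<epsilon>\<bar>\<close>.\<close>

lemma kink_not_differentiable:
  fixes h :: "real \<Rightarrow> real"
  assumes "\<forall>\<^sub>F \<epsilon> in nhds 0. \<bar>h \<epsilon> - l - max 0 (- \<epsilon> * s)\<bar> \<le> C * \<epsilon>\<^sup>2" "s \<noteq> 0"
  shows "\<not> h differentiable (at 0)"
proof
  assume h: "h differentiable (at 0)"
  \<comment> \<open>\<open>r\<close> is \<open>h\<close> with the kink removed: it stays within
    \<open>C * \<epsilon>\<^sup>2\<close> of the constant \<open>l\<close>. If \<open>h\<close> were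
    differentiable, the kink \<open>h - r\<close> would be as well.\<close>
  define r where "r \<epsilon> = h \<epsilon> - max 0 (- \<epsilon> * s)" for \<epsilon>
  have "(r has_vector_derivative 0) (at 0)"
    by (rule has_vector_derivative_of_quadratic_bound[of _ l _ C])
      (use assms(1) in \<open>simp add: r_def algebra_simps\<close>)
  then have "r differentiable (at 0)"
    by (rule differentiableI_vector)
  with h have "(\<lambda>\<epsilon>. (2 * (h \<epsilon> - r \<epsilon>) + \<epsilon> * s) / \<bar>s\<bar>) differentiable (at 0)"
    using assms(2) by (intro derivative_intros) auto
  moreover have "2 * (h \<epsilon> - r \<epsilon>) + \<epsilon> * s = \<bar>\<epsilon>\<bar> * \<bar>s\<bar>" for \<epsilon>
    unfolding r_def abs_mult[symmetric] by (simp add: max_def abs_if)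
  ultimately show False
    using abs_not_differentiable_at_0 assms(2) by simp
qed

section \<open>Expansion of the perturbed solution with quadratic error\<close>

text \<open>Since \<open>\<parallel>y\<parallel>\<^sup>2 = \<Delta>\<^sup>2 + 2 x \<bullet> (y - x) + \<parallel>y - x\<parallel>\<^sup>2\<close>, the inner product \<open>x \<bullet> (y - x)\<close> is \<open>O(\<epsilon>\<^sup>2)\<close> if
  \<open>\<mu> > 0\<close> and nonpositive if \<open>\<mu> = 0\<close>, which gives the last estimate.\<close>

lemma trs_perturbation_expansion:
  fixes A E :: "real ^ 'n ^ 'n" and e g x :: "real ^ 'n"
  assumes pd: "pos_def A" and x: "A *v x = - g" "norm x = \<Delta>" and "\<Delta> > 0"
  defines "p \<equiv> matrix_inv A *v (e + E *v x)" and "z \<equiv> matrix_inv A *v x"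
  obtains K where
    "\<And>\<epsilon> \<mu> y. trs_solution (A + \<epsilon> *\<^sub>R E) (g + \<epsilon> *\<^sub>R e) \<Delta> \<mu> y \<Longrightarrow>
       norm (y - x) \<le> K * \<bar>\<epsilon>\<bar> \<and> \<bar>\<mu>\<bar> \<le> K * \<bar>\<epsilon>\<bar> \<and>
       norm (y - x + \<epsilon> *\<^sub>R p + \<mu> *\<^sub>R z) \<le> K * \<epsilon>\<^sup>2 \<and>
       \<bar>\<mu> * (x \<bullet> z) - max 0 (- \<epsilon> * (x \<bullet> p))\<bar> \<le> K * \<epsilon>\<^sup>2"
proof -
  obtain c where c: "c > 0" "\<And>v. c * (norm v)\<^sup>2 \<le> v \<bullet> (A *v v)"
    using pos_def_coercive[OF pd] by metis
  obtain a where a: "a > 0" "\<And>v. norm (A *v v) \<le> a * norm v"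
    using matrix_vector_bound[of A] by blast
  obtain b where b: "b > 0" "\<And>v. norm (E *v v) \<le> b * norm v"
    using matrix_vector_bound[of E] by blast
  obtain k where k: "k > 0" "\<And>v. norm (matrix_inv A *v v) \<le> k * norm v"
    using matrix_vector_bound[of "matrix_inv A"] by blast
  note inv = invertible_matrix_inv_vec[OF pos_def_invertible[OF pd]]
  \<comment> \<open>\<open>W\<close> bounds \<open>norm (e + E *v y)\<close> over the ball.
    \<open>K1\<close> and \<open>K2\<close> are the resulting Lipschitz constants for
    \<open>y - x\<close> and \<open>\<mu>\<close>, \<open>K3\<close> bounds the second-order
    remainder \<open>w\<close>, and \<open>K4\<close> bounds the kink error, combining
    \<open>x \<bullet> w\<close> with \<open>d \<bullet> d\<close>. All are nonnegative, so their
    sum dominates each.\<close>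
  define W where "W = norm e + b * \<Delta>"
  define K1 where "K1 = W / c"
  define K2 where "K2 = (W + a * K1) / \<Delta>"
  define K3 where "K3 = k * (b * K1 + K2 * K1)"
  define K4 where "K4 = \<Delta> * K3 + K1\<^sup>2"
  have pos: "W \<ge> 0" "K1 \<ge> 0" "K2 \<ge> 0" "K3 \<ge> 0" "K4 \<ge> 0"
    using a b c k \<open>\<Delta> > 0\<close> by (simp_all add: W_def K1_def K2_def K3_def K4_def)
  show thesis
  proof (rule that[of "K1 + K2 + K3 + K4"])
    fix \<epsilon> \<mu> y
    assume sol: "trs_solution (A + \<epsilon> *\<^sub>R E) (g + \<epsilon> *\<^sub>R e) \<Delta> \<mu> y"
    note bounds = trs_perturbation_bounds[OF c(2) x sol]
    have y: "norm y \<le> \<Delta>" "\<mu> \<ge> 0" "\<mu> * (\<Delta> - norm y) = 0"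
      using sol by (auto simp: trs_solution_def trs_minimizer_def trs_multiplier_def)
    define d where "d = y - x"
    define w where "w = d + \<epsilon> *\<^sub>R p + \<mu> *\<^sub>R z"
    have "norm (e + E *v y) \<le> norm e + b * norm y"
      using norm_triangle_ineq b(2) order_trans add_left_mono by meson
    also have "\<dots> \<le> W"
      using y(1) b(1) by (simp add: W_def)
    finally have W: "\<bar>\<epsilon>\<bar> * norm (e + E *v y) \<le> W * \<bar>\<epsilon>\<bar>"
      by (subst mult.commute) (rule mult_right_mono, simp_all)
    have d: "norm d \<le> K1 * \<bar>\<epsilon>\<bar>"
      using order_trans[OF bounds(2) W] c(1) by (simp add: d_def K1_def field_simps)
    have "\<mu> * \<Delta> \<le> W * \<bar>\<epsilon>\<bar> + a * norm d"
      using bounds(3) W a(2)[of d] by (simp add: d_def)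
    also have "\<dots> \<le> W * \<bar>\<epsilon>\<bar> + a * (K1 * \<bar>\<epsilon>\<bar>)"
      using d a(1) by simp
    finally have \<mu>: "\<mu> \<le> K2 * \<bar>\<epsilon>\<bar>"
      using \<open>\<Delta> > 0\<close> by (simp add: K2_def field_simps)
    have "d = matrix_inv A *v (- \<epsilon> *\<^sub>R (e + E *v y) - \<mu> *\<^sub>R y)"
      unfolding bounds(1)[symmetric] inv d_def ..
    \<comment> \<open>Substituting \<open>y = x + d\<close> isolates the corrections
      \<open>\<epsilon> *\<^sub>R (E *v d)\<close> and \<open>\<mu> *\<^sub>R d\<close>, each a
      product of two first-order quantities.\<close>
    also have "- \<epsilon> *\<^sub>R (e + E *v y) - \<mu> *\<^sub>R y =
        - (\<epsilon> *\<^sub>R (e + E *v x)) - \<mu> *\<^sub>R x - (\<epsilon> *\<^sub>R (E *v d) + \<mu> *\<^sub>R d)"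
      by (simp add: d_def matrix_vector_mult_diff_distrib algebra_simps)
    also have "matrix_inv A *v \<dots> =
        - \<epsilon> *\<^sub>R p - \<mu> *\<^sub>R z - matrix_inv A *v (\<epsilon> *\<^sub>R (E *v d) + \<mu> *\<^sub>R d)"
      unfolding p_def z_def scaleR_minus_left[symmetric]
      by (simp only: matrix_vector_mult_diff_distrib matrix_vector_mult_scaleR)
    finally have "w = - (matrix_inv A *v (\<epsilon> *\<^sub>R (E *v d) + \<mu> *\<^sub>R d))"
      by (simp add: w_def eq_diff_eq eq_neg_iff_add_eq_0 algebra_simps)
    then have "norm w \<le> k * norm (\<epsilon> *\<^sub>R (E *v d) + \<mu> *\<^sub>R d)"
      using k(2) by simp
    also have "norm (\<epsilon> *\<^sub>R (E *v d) + \<mu> *\<^sub>R d) \<le> \<bar>\<epsilon>\<bar> * norm (E *v d) + \<mu> * norm d"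
      using norm_triangle_ineq[of "\<epsilon> *\<^sub>R (E *v d)" "\<mu> *\<^sub>R d"] y(2) by simp
    also have "\<dots> \<le> \<bar>\<epsilon>\<bar> * (b * (K1 * \<bar>\<epsilon>\<bar>)) + K2 * \<bar>\<epsilon>\<bar> * (K1 * \<bar>\<epsilon>\<bar>)"
      using order_trans[OF b(2) mult_left_mono[OF d]] b(1) y(2) d \<mu> pos
      by (intro add_mono mult_mono) auto
    also have "k * \<dots> = K3 * \<epsilon>\<^sup>2"
      by (simp add: K3_def power2_eq_square algebra_simps)
    finally have w: "norm w \<le> K3 * \<epsilon>\<^sup>2"
      using k(1) by simp
    have "\<bar>x \<bullet> w\<bar> \<le> \<Delta> * norm w"
      using Cauchy_Schwarz_ineq2[of x w] x(2) by simp
    then have xw: "\<bar>x \<bullet> w\<bar> \<le> \<Delta> * K3 * \<epsilon>\<^sup>2"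
      using mult_left_mono[OF w less_imp_le[OF \<open>\<Delta> > 0\<close>]] by (simp add: mult.assoc)
    have "(norm d)\<^sup>2 \<le> (K1 * \<bar>\<epsilon>\<bar>)\<^sup>2"
      using d by (intro power_mono) auto
    then have d2: "d \<bullet> d \<le> K1\<^sup>2 * \<epsilon>\<^sup>2"
      by (simp add: power2_norm_eq_inner power_mult_distrib)
    have yy: "y \<bullet> y = \<Delta>\<^sup>2 + 2 * (x \<bullet> d) + d \<bullet> d"
      unfolding x(2)[symmetric] power2_norm_eq_inner
      by (simp add: d_def inner_diff_left inner_diff_right inner_commute)
    have q: "\<mu> * (x \<bullet> z) = - \<epsilon> * (x \<bullet> p) + x \<bullet> w - x \<bullet> d"
      by (simp add: w_def inner_add_right)
    have sign: "0 \<le> \<mu> * (x \<bullet> z)"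
    proof -
      have "x \<bullet> z = z \<bullet> (A *v z)"
        by (simp add: z_def inv inner_commute)
      then have "x \<bullet> z \<ge> 0"
        using pd by (cases "z = 0") (auto simp: pos_def_def less_imp_le)
      then show ?thesis using y(2) by simp
    qed
    have "\<bar>\<mu> * (x \<bullet> z) - max 0 (- \<epsilon> * (x \<bullet> p))\<bar> \<le> K4 * \<epsilon>\<^sup>2"
    proof (cases "\<mu> = 0")
      case True
      have "y \<bullet> y \<le> \<Delta>\<^sup>2"
        using y(1) by (simp add: power_mono flip: power2_norm_eq_inner)
      then have "x \<bullet> d \<le> 0"
        using yy inner_ge_zero[of d] by linarith
      \<comment> \<open>For \<open>\<mu> = 0\<close>, \<open>q\<close> says that
        \<open>- \<epsilon> * (x \<bullet> p)\<close> equals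
        \<open>x \<bullet> d - x \<bullet> w\<close>, so its positive part is at most
        \<open>\<bar>x \<bullet> w\<bar>\<close>.\<close>
      then have "- \<epsilon> * (x \<bullet> p) \<le> \<bar>x \<bullet> w\<bar>"
        using q True by simp
      also have "\<dots> \<le> K4 * \<epsilon>\<^sup>2"
        using xw by (simp add: K4_def algebra_simps add_increasing2)
      finally show ?thesis
        using True pos(5) by (simp add: max_def)
    next
      case False
      then have "y \<bullet> y = \<Delta>\<^sup>2"
        using y(3) by (simp flip: power2_norm_eq_inner)
      then have "\<bar>x \<bullet> d\<bar> \<le> K1\<^sup>2 * \<epsilon>\<^sup>2"
        using yy inner_ge_zero[of d] d2 by linarith
      then have "\<bar>\<mu> * (x \<bullet> z) - - \<epsilon> * (x \<bullet> p)\<bar> \<le> K4 * \<epsilon>\<^sup>2"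
        using q xw unfolding K4_def distrib_right by linarith
      \<comment> \<open>Replacing a negative number by 0 can only bring it closer to the nonnegative
        \<open>\<mu> * (x \<bullet> z)\<close>.\<close>
      then show ?thesis
        using sign unfolding max_def by (split if_split) linarith
    qed
    moreover have "K1 * \<bar>\<epsilon>\<bar> \<le> (K1 + K2 + K3 + K4) * \<bar>\<epsilon>\<bar>" "K2 * \<bar>\<epsilon>\<bar> \<le> (K1 + K2 + K3 + K4) * \<bar>\<epsilon>\<bar>"
      "K3 * \<epsilon>\<^sup>2 \<le> (K1 + K2 + K3 + K4) * \<epsilon>\<^sup>2" "K4 * \<epsilon>\<^sup>2 \<le> (K1 + K2 + K3 + K4) * \<epsilon>\<^sup>2"
      using pos by (auto intro!: mult_right_mono)
    ultimately show "norm (y - x) \<le> (K1 + K2 + K3 + K4) * \<bar>\<epsilon>\<bar> \<and>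
       \<bar>\<mu>\<bar> \<le> (K1 + K2 + K3 + K4) * \<bar>\<epsilon>\<bar> \<and>
       norm (y - x + \<epsilon> *\<^sub>R p + \<mu> *\<^sub>R z) \<le> (K1 + K2 + K3 + K4) * \<epsilon>\<^sup>2 \<and>
       \<bar>\<mu> * (x \<bullet> z) - max 0 (- \<epsilon> * (x \<bullet> p))\<bar> \<le> (K1 + K2 + K3 + K4) * \<epsilon>\<^sup>2"
      using d \<mu> w y(2) unfolding w_def d_def by linarith
  qed
qed

section \<open>Continuity at 0 and the three claims\<close>

lemma isCont_of_linear_bound:
  fixes f :: "real \<Rightarrow> 'a :: real_normed_vector"
  assumes "\<forall>\<^sub>F \<epsilon> in nhds 0. norm (f \<epsilon> - l) \<le> K * \<bar>\<epsilon>\<bar>"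
  shows "f 0 = l" "isCont f 0"
proof -
  show "f 0 = l"
    using eventually_nhds_x_imp_x[OF assms] by simp
  have "((\<lambda>\<epsilon>. K * \<bar>\<epsilon>\<bar>) \<longlongrightarrow> 0) (at (0::real))"
    by (auto intro!: tendsto_eq_intros)
  moreover have "\<forall>\<^sub>F \<epsilon> in at 0. norm (f \<epsilon> - l) \<le> K * \<bar>\<epsilon>\<bar>"
    using assms eventually_nhds_conv_at by blast
  ultimately have "((\<lambda>\<epsilon>. f \<epsilon> - l) \<longlongrightarrow> 0) (at 0)"
    by (rule Lim_null_comparison[rotated])
  then show "isCont f 0"
    unfolding isCont_def \<open>f 0 = l\<close> by (rule LIM_zero_cancel)
qed

theorem theorem3p10:
  fixes A E :: "real ^ 'n ^ 'n" and g e :: "real ^ 'n" and \<Delta> :: real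
    and lam :: real and x :: "real ^ 'n"
    and lam_eps :: "real \<Rightarrow> real" and x_eps :: "real \<Rightarrow> real ^ 'n"
  assumes "transpose A = A" and "transpose E = E" and "g \<noteq> 0" and "\<Delta> > 0"
    and "trs_solution A g \<Delta> lam x"
    and "\<forall>\<^sub>F \<epsilon> in nhds 0.
           trs_solution (A + \<epsilon> *\<^sub>R E) (g + \<epsilon> *\<^sub>R e) \<Delta> (lam_eps \<epsilon>) (x_eps \<epsilon>)"
    and "\<forall>\<^sub>F \<epsilon> in nhds 0. trs_easy_case (A + \<epsilon> *\<^sub>R E) (g + \<epsilon> *\<^sub>R e) \<Delta>"
    and "trs_easy_case A g \<Delta>" and "norm x = \<Delta>" and "lam = 0"
  shows "(isCont lam_eps 0 \<and> isCont x_eps 0 \<and>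
          (lam_eps \<longlongrightarrow> lam) (at 0) \<and> (x_eps \<longlongrightarrow> x) (at 0)) \<and>
         (x \<bullet> (matrix_inv A *v (e + E *v x)) \<noteq> 0 \<longrightarrow>
            \<not> lam_eps differentiable (at 0) \<and> \<not> x_eps differentiable (at 0)) \<and>
         (x \<bullet> (matrix_inv A *v (e + E *v x)) = 0 \<longrightarrow>
            (lam_eps has_real_derivative 0) (at 0) \<and>
            (x_eps has_vector_derivative - (matrix_inv A *v (E *v x + e))) (at 0))"
proof -
  define p where "p = matrix_inv A *v (e + E *v x)"
  define z where "z = matrix_inv A *v x"
  define q where "q = x \<bullet> z"
  have x: "A *v x = - g" and pd: "pos_def A"
    using assms(4,5,8,9,10) trs_easy_case_pos_def
    by (auto simp: trs_solution_def trs_multiplier_def)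
  obtain K where K: "\<And>\<epsilon> \<mu> y. trs_solution (A + \<epsilon> *\<^sub>R E) (g + \<epsilon> *\<^sub>R e) \<Delta> \<mu> y \<Longrightarrow>
       norm (y - x) \<le> K * \<bar>\<epsilon>\<bar> \<and> \<bar>\<mu>\<bar> \<le> K * \<bar>\<epsilon>\<bar> \<and>
       norm (y - x + \<epsilon> *\<^sub>R p + \<mu> *\<^sub>R z) \<le> K * \<epsilon>\<^sup>2 \<and>
       \<bar>\<mu> * q - max 0 (- \<epsilon> * (x \<bullet> p))\<bar> \<le> K * \<epsilon>\<^sup>2"
    unfolding p_def z_def q_def
    using trs_perturbation_expansion[OF pd x assms(9,4)] by metis
  have bounds: "\<forall>\<^sub>F \<epsilon> in nhds 0. norm (x_eps \<epsilon> - x) \<le> K * \<bar>\<epsilon>\<bar>"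
      "\<forall>\<^sub>F \<epsilon> in nhds 0. norm (lam_eps \<epsilon> - 0) \<le> K * \<bar>\<epsilon>\<bar>"
      "\<forall>\<^sub>F \<epsilon> in nhds 0. norm (x_eps \<epsilon> - x + \<epsilon> *\<^sub>R p + lam_eps \<epsilon> *\<^sub>R z) \<le> K * \<epsilon>\<^sup>2"
      "\<forall>\<^sub>F \<epsilon> in nhds 0. \<bar>lam_eps \<epsilon> * q - max 0 (- \<epsilon> * (x \<bullet> p))\<bar> \<le> K * \<epsilon>\<^sup>2"
    using assms(6) by (auto elim!: eventually_mono dest: K)
  note x_cont = isCont_of_linear_bound[OF bounds(1)]
  note lam_cont = isCont_of_linear_bound[OF bounds(2)]
  \<comment> \<open>Here \<open>x \<noteq> 0\<close> gives \<open>z \<noteq> 0\<close>, so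
    \<open>q\<close> is the value of the positive definite form at \<open>z\<close>. Strict
    positivity permits division by \<open>q\<close> below.\<close>
  have "x = A *v z"
    by (simp add: z_def invertible_matrix_inv_vec[OF pos_def_invertible[OF pd]])
  then have "q > 0"
    using pd assms(4,9) by (cases "z = 0") (auto simp: q_def pos_def_def inner_commute[of "A *v z"])
  have "\<not> lam_eps differentiable (at 0) \<and> \<not> x_eps differentiable (at 0)" if s: "x \<bullet> p \<noteq> 0"
  proof
    have "\<not> (\<lambda>\<epsilon>. lam_eps \<epsilon> * q) differentiable (at 0)"
      using bounds(4) s by (intro kink_not_differentiable[of _ 0 "x \<bullet> p" K]) auto
    then show "\<not> lam_eps differentiable (at 0)"
      by (auto intro: derivative_intros)
    \<comment> \<open>The functional \<open>- (x \<bullet> _)\<close> detects the kink of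
      \<open>x_eps\<close>. Inserting the estimate for \<open>lam_eps \<epsilon> * q\<close> into
      the expansion leaves \<open>\<epsilon> * (x \<bullet> p) + max 0 (- \<epsilon> * (x \<bullet>
      p))\<close>, which is the kink with the sign of the slope reversed.\<close>
    have "\<forall>\<^sub>F \<epsilon> in nhds 0.
        \<bar>- (x \<bullet> x_eps \<epsilon>) - (- (x \<bullet> x)) - max 0 (- \<epsilon> * - (x \<bullet> p))\<bar> \<le> (\<Delta> * K + K) * \<epsilon>\<^sup>2"
      using bounds(3,4)
    proof eventually_elim
      case (elim \<epsilon>)
      define w where "w = x_eps \<epsilon> - x + \<epsilon> *\<^sub>R p + lam_eps \<epsilon> *\<^sub>R z"
      have "\<bar>x \<bullet> w\<bar> \<le> \<Delta> * norm w"
        using Cauchy_Schwarz_ineq2[of x w] assms(9) by simp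
      also have "\<dots> \<le> \<Delta> * (K * \<epsilon>\<^sup>2)"
        using elim(1) assms(4) by (simp add: w_def)
      finally have "\<bar>x \<bullet> w\<bar> \<le> \<Delta> * K * \<epsilon>\<^sup>2"
        by simp
      moreover have "x \<bullet> w = x \<bullet> x_eps \<epsilon> - x \<bullet> x + \<epsilon> * (x \<bullet> p) + lam_eps \<epsilon> * q"
        by (simp add: w_def q_def inner_add_right inner_diff_right)
      moreover have "max 0 (- \<epsilon> * - (x \<bullet> p)) = max 0 (- \<epsilon> * (x \<bullet> p)) + \<epsilon> * (x \<bullet> p)"
        by (simp add: max_def)
      ultimately show ?case
        using elim(2) unfolding distrib_right by linarith
    qed
    then have "\<not> (\<lambda>\<epsilon>. - (x \<bullet> x_eps \<epsilon>)) differentiable (at 0)"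
      by (rule kink_not_differentiable) (use s in simp)
    then show "\<not> x_eps differentiable (at 0)"
      by (auto intro: derivative_intros)
  qed
  moreover have "(lam_eps has_real_derivative 0) (at 0) \<and> (x_eps has_vector_derivative - p) (at 0)"
    if s: "x \<bullet> p = 0"
  proof
    \<comment> \<open>The maximum vanishes when \<open>x \<bullet> p = 0\<close>, so the multiplier
      itself is of second order.\<close>
    have lam: "\<forall>\<^sub>F \<epsilon> in nhds 0. \<bar>lam_eps \<epsilon>\<bar> \<le> K / q * \<epsilon>\<^sup>2"
      using bounds(4) by eventually_elim (use \<open>q > 0\<close> s in \<open>simp add: abs_mult field_simps\<close>)
    show "(lam_eps has_real_derivative 0) (at 0)"
      unfolding has_real_derivative_iff_has_vector_derivative
      by (rule has_vector_derivative_of_quadratic_bound[of _ 0 _ "K / q"]) (use lam in simp)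
    \<comment> \<open>The term \<open>lam_eps \<epsilon> *\<^sub>R z\<close> is now absorbed into
      the quadratic remainder, and only the linear term with slope \<open>- p\<close>
      survives.\<close>
    have "\<forall>\<^sub>F \<epsilon> in nhds 0. norm (x_eps \<epsilon> - x - \<epsilon> *\<^sub>R - p) \<le> (K + K / q * norm z) * \<epsilon>\<^sup>2"
      using bounds(3) lam
    proof eventually_elim
      case (elim \<epsilon>)
      have "norm (x_eps \<epsilon> - x - \<epsilon> *\<^sub>R - p) \<le>
          norm (x_eps \<epsilon> - x + \<epsilon> *\<^sub>R p + lam_eps \<epsilon> *\<^sub>R z) + norm (lam_eps \<epsilon> *\<^sub>R z)"
        using norm_triangle_ineq4[of "x_eps \<epsilon> - x + \<epsilon> *\<^sub>R p + lam_eps \<epsilon> *\<^sub>R z" "lam_eps \<epsilon> *\<^sub>R z"]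
        by simp
      moreover have "norm (lam_eps \<epsilon> *\<^sub>R z) \<le> K / q * \<epsilon>\<^sup>2 * norm z"
        unfolding norm_scaleR real_norm_def using elim(2) by (rule mult_right_mono) simp
      ultimately show ?case
        using elim(1) by (simp add: algebra_simps)
    qed
    then show "(x_eps has_vector_derivative - p) (at 0)"
      by (rule has_vector_derivative_of_quadratic_bound)
  qed
  moreover have "isCont lam_eps 0" "isCont x_eps 0" "(lam_eps \<longlongrightarrow> lam) (at 0)" "(x_eps \<longlongrightarrow> x) (at 0)"
    using x_cont lam_cont assms(10) unfolding isCont_def by simp_all
  ultimately show ?thesis
    unfolding add.commute[of "E *v x" e] p_def[symmetric] by blast
qed

end
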